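(* Let $\omega\in\mathcal{W}_0$ be given and let $\mathcal{M}_\omega=\{W^{(l)}:l>0\}$ be the associated weight matrix, with quotient sequences $\vartheta^{(l)}$. Then the following are equivalent (where "and/or" in (i) and (v) means that the equivalence holds for each of the readings: the Roumieu type property, the Beurling type property, or both): (i) $\mathcal{M}_\omega$ satisfies the quotient/root comparison property of Roumieu type and/or of Beurling type. (ii) $\exists\, A\ge 1\ \exists\, c\ge 1\ \forall\, x\in\mathbb{N}_{>0}\ \forall\, p\in\mathbb{N}_{>0}:\ \vartheta^{(x)}_p\le A\,(W^{(cx)}_p)^{1/p}$. (iii) $\exists\, c\ge 1\ \forall\, x\in\mathbb{N}_{>0}\ \exists\, A\ge 1\ \forall\, p\in\mathbb{N}_{>0}:\ \vartheta^{(1/(cx))}_p\le A\,(W^{(1/x)}_p)^{1/p}$. (iv) $\exists\, d\in\mathbb{N}_{>0}\ \exists\, A\ge 1\ \forall\, p\in\mathbb{N}_{>0}:\ \vartheta^{(1)}_p\le A\,(W^{(1)}_{dp})^{1/(dp)}$. (v) The matrix $\mathcal{M}_{\omega_{W^{(1)}}}$ associated with the weight $\omega_{W^{(1)}}\in\mathcal{W}_0$ satisfies the quotient/root comparison property of Roumieu type and/or of Beurling type.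
   Context: $\mathbb{N}=\{0,1,2,\dots\}$, $\mathbb{N}_{>0}=\{1,2,\dots\}$. $\mathcal{W}_0$ is the set of functions $\omega:[0,+\infty)\to[0,+\infty)$ that are continuous, nondecreasing, satisfy $\omega(t)=0$ for $t\in[0,1]$ and $\lim_{t\to+\infty}\omega(t)=+\infty$, $\log t=o(\omega(t))$ as $t\to+\infty$, and such that $\varphi_\omega:t\mapsto\omega(e^t)$ is convex on $\mathbb{R}$. For $\omega\in\mathcal{W}_0$ put $\varphi^*_\omega(x):=\sup\{xy-\varphi_\omega(y):y\ge0\}$ for $x\ge 0$. The associated weight matrix is $\mathcal{M}_\omega:=\{W^{(l)}:l>0\}$ with $W^{(l)}_p:=\exp\big(\tfrac1l\varphi^*_\omega(lp)\big)$, $p\in\mathbb{N}$; put $\vartheta^{(l)}_p:=W^{(l)}_p/W^{(l)}_{p-1}$ for $p\ge 1$, $\vartheta^{(l)}_0:=1$. For a sequence $M=(M_p)_p$ of positive reals with $M_0=1$ and $(M_p)^{1/p}\to+\infty$, $\omega_M(t):=\sup_{p\in\mathbb{N}}\log(t^p/M_p)$ for $t>0$, $\omega_M(0):=0$. A family of sequences $\{M^{(x)}:x>0\}$ with quotients $\mu^{(x)}_p:=M^{(x)}_p/M^{(x)}_{p-1}$ has the quotient/root comparison property of Roumieu type if $\forall x>0\ \exists y>0\ \exists A\ge 1\ \forall p\in\mathbb{N}_{>0}:\ \mu^{(x)}_p\le A(M^{(y)}_p)^{1/p}$, and of Beurling type if $\forall x>0\ \exists y>0\ \exists A\ge 1\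 \forall p\in\mathbb{N}_{>0}:\ \mu^{(y)}_p\le A(M^{(x)}_p)^{1/p}$. *)

theory Defs
  imports "HOL-Analysis.Analysis" "HOL-Library.Landau_Symbols"
begin

text \<open>
  Weights are functions on the half-line, represented as total functions on the reals whose
  values at negative arguments are never constrained or used.
\<close>

definition weights0 :: "(real \<Rightarrow> real) set" where
  "weights0 = {\<omega>.
     (\<forall>t\<ge>0. \<omega> t \<ge> 0) \<and>
     continuous_on {0..} \<omega> \<and>
     mono_on {0..} \<omega> \<and>
     (\<forall>t\<in>{0..1}. \<omega> t = 0) \<and>
     filterlim \<omega> at_top at_top \<and>
     ln \<in> o[at_top](\<omega>) \<and>
     convex_on UNIV (\<lambda>t. \<omega> (exp t))}"

text \<open>
  The supremum is taken in the reals. For a weight in \<open>weights0\<close> and \<open>x \<ge> 0\<close> the set is bounded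
  above, because \<open>ln\<close> is negligible against the weight.
\<close>

definition phi_star :: "(real \<Rightarrow> real) \<Rightarrow> real \<Rightarrow> real" where
  "phi_star \<omega> x = (SUP y\<in>{0..}. x * y - \<omega> (exp y))"

definition weight_matrix :: "(real \<Rightarrow> real) \<Rightarrow> real \<Rightarrow> nat \<Rightarrow> real" where
  "weight_matrix \<omega> l p = exp (1 / l * phi_star \<omega> (l * real p))"

definition quotient_seq :: "(nat \<Rightarrow> real) \<Rightarrow> nat \<Rightarrow> real" where
  "quotient_seq M p = (if p = 0 then 1 else M p / M (p - 1))"

text \<open>
  Here too the supremum is a real one; it is finite whenever \<open>M\<close> is positive and
  the \<open>p\<close>-th roots of \<open>M p\<close> tend to infinity.
\<close>

definition assoc_weight :: "(nat \<Rightarrow> real) \<Rightarrow> real \<Rightarrow> real" where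
  "assoc_weight M t = (if t > 0 then (SUP p. ln (t ^ p / M p)) else 0)"

text \<open>
  A family indexed by the positive reals is a function of a real index, restricted to positive
  arguments by the quantifiers.
\<close>

definition quotient_root_Roumieu :: "(real \<Rightarrow> nat \<Rightarrow> real) \<Rightarrow> bool" where
  "quotient_root_Roumieu M \<longleftrightarrow>
     (\<forall>x>0. \<exists>y>0. \<exists>A\<ge>1. \<forall>p>0. quotient_seq (M x) p \<le> A * M y p powr (1 / real p))"

definition quotient_root_Beurling :: "(real \<Rightarrow> nat \<Rightarrow> real) \<Rightarrow> bool" where
  "quotient_root_Beurling M \<longleftrightarrow>
     (\<forall>x>0. \<exists>y>0. \<exists>A\<ge>1. \<forall>p>0. quotient_seq (M y) p \<le> A * M x p powr (1 / real p))"

end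

theory Submission imports Defs begin

text \<open>
  Put \<open>\<psi> = phi_star \<omega>\<close>, which is convex and nonnegative with \<open>\<psi> 0 = 0\<close>. The logarithm of the
  quotient \<open>\<vartheta>\<^sup>(\<^sup>l\<^sup>)\<^sub>p\<close> is the slope of \<open>\<psi>\<close> on \<open>[lp - l, lp]\<close>, and the logarithm of the root
  \<open>(W\<^sup>(\<^sup>m\<^sup>)\<^sub>p)\<^sup>1\<^sup>/\<^sup>p\<close> is \<open>\<psi> (mp) / (mp)\<close>. Slopes and the ratio \<open>\<psi> x / x\<close> are monotone, so a comparison
  of the two for one pair \<open>(l, m)\<close> gives, after rounding \<open>t\<close> up to a multiple of \<open>l\<close>, a comparison for
  all pairs \<open>(k, H k)\<close> with constants independent of \<open>k\<close>. Each of (i)-(iv) lies between these two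
  properties. For (v), the conjugate belonging to \<open>\<omega>\<^sub>W\<close> with \<open>W = W\<^sup>(\<^sup>1\<^sup>)\<close> agrees with \<open>\<psi>\<close> on the
  integers, so both weights have the same \<open>W\<^sup>(\<^sup>1\<^sup>)\<close>, and (iv) depends on nothing else.
\<close>

section \<open>Convex functions: suprema, slopes and the slope-ratio bound\<close>

lemma convex_on_cSUP:
  fixes f :: "'i \<Rightarrow> 'a::real_vector \<Rightarrow> real"
  assumes "K \<noteq> {}" "convex S"
    and conv: "\<And>k. k \<in> K \<Longrightarrow> convex_on S (f k)"
    and bdd: "\<And>x. x \<in> S \<Longrightarrow> bdd_above ((\<lambda>k. f k x) ` K)"
  shows "convex_on S (\<lambda>x. SUP k\<in>K. f k x)"
proof (rule convex_onI)
  fix t :: real and x y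
  assume t: "t > 0" "t < 1" and xy: "x \<in> S" "y \<in> S"
  show "(SUP k\<in>K. f k ((1 - t) *\<^sub>R x + t *\<^sub>R y))
      \<le> (1 - t) * (SUP k\<in>K. f k x) + t * (SUP k\<in>K. f k y)"
  proof (rule cSUP_least)
    fix k assume k: "k \<in> K"
    have "f k ((1 - t) *\<^sub>R x + t *\<^sub>R y) \<le> (1 - t) * f k x + t * f k y"
      using convex_onD[OF conv[OF k], of t x y] t xy by auto
    also have "\<dots> \<le> (1 - t) * (SUP k\<in>K. f k x) + t * (SUP k\<in>K. f k y)"
      using t xy k bdd by (intro add_mono mult_left_mono cSUP_upper) auto
    finally show "f k ((1 - t) *\<^sub>R x + t *\<^sub>R y)
        \<le> (1 - t) * (SUP k\<in>K. f k x) + t * (SUP k\<in>K. f k y)" .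
  qed (use assms in auto)
qed (use assms in auto)

lemma convex_on_affine_real: "convex_on UNIV (\<lambda>y::real. a * y - b)"
  by (rule convex_onI) (auto simp: algebra_simps)

text \<open>Both slopes are compared with the slope over \<open>[s, t']\<close>: the endpoints move
  to the right one at a time, so overlapping and disjoint intervals are treated alike.\<close>

lemma convex_on_slope_mono:
  fixes f :: "real \<Rightarrow> real"
  assumes f: "convex_on I f" and "s \<in> I" "t \<in> I" "s' \<in> I" "t' \<in> I"
    and "s < t" "s' < t'" "s \<le> s'" "t \<le> t'"
  shows "(f t - f s) / (t - s) \<le> (f t' - f s') / (t' - s')"
proof -
  have swap: "(f x - f y) / (x - y) = (f y - f x) / (y - x)" for x y
    by (metis minus_diff_eq minus_divide_divide)
  have "(f t - f s) / (t - s) \<le> (f t' - f s) / (t' - s)"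
    using convex_on_slope_le(1)[OF f, of s t' t] assms
    by (cases "t = t'") (auto simp: swap[of s])
  also have "\<dots> \<le> (f t' - f s') / (t' - s')"
    using convex_on_slope_le(2)[OF f, of s t' s'] assms
    by (cases "s = s'") (auto simp: swap[of _ t'])
  finally show ?thesis .
qed

text \<open>Logarithmic form of a quotient/root inequality, with \<open>a\<close> the logarithm of
  the constant. It is stated for a general \<open>f\<close> so that the change of parameters becomes
  a question about convex functions alone.\<close>

definition slope_ratio_bound :: "(real \<Rightarrow> real) \<Rightarrow> real \<Rightarrow> real \<Rightarrow> real \<Rightarrow> bool" where
  "slope_ratio_bound f l m a \<longleftrightarrow>
     (\<forall>p>0::nat. (f (l * real p) - f (l * real p - l)) / l \<le> a + f (m * real p) / (m * real p))"

text \<open>Since \<open>f 0 = 0\<close>, the ratio \<open>f s / s\<close> is the slope over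
  \<open>[0, s]\<close>.\<close>

lemma convex_ratio_mono:
  fixes f :: "real \<Rightarrow> real"
  assumes "convex_on {0..} f" "f 0 = 0" "0 < s" "s \<le> t"
  shows "f s / s \<le> f t / t"
  using convex_on_slope_mono[OF assms(1), of 0 s 0 t] assms by auto

lemma slope_ratio_bound_mono:
  assumes "convex_on {0..} f" "f 0 = 0" "0 < m" "m \<le> m'" "slope_ratio_bound f l m a"
  shows "slope_ratio_bound f l m' a"
  unfolding slope_ratio_bound_def
proof (intro allI impI)
  fix p :: nat assume p: "0 < p"
  have "f (m * real p) / (m * real p) \<le> f (m' * real p) / (m' * real p)"
    using assms p by (intro convex_ratio_mono) (auto intro: mult_right_mono)
  then show "(f (l * real p) - f (l * real p - l)) / l \<le> a + f (m' * real p) / (m' * real p)"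
    using assms(5)[unfolded slope_ratio_bound_def, rule_format, OF p] by linarith
qed

lemma slope_ratio_bound_uniform:
  assumes conv: "convex_on {0..} f" and f0: "f 0 = 0" and nonneg: "\<And>x. x \<ge> 0 \<Longrightarrow> f x \<ge> 0"
    and l: "l > 0" and m: "m > 0" and bound: "slope_ratio_bound f l m a"
  shows "\<exists>H\<ge>1. \<exists>b\<ge>0. \<forall>k>0. slope_ratio_bound f k (H * k) b"
proof -
  \<comment> \<open>The factor \<open>3 * m / l\<close> comes from \<open>q \<le> 3 * t / l\<close>
    below; the second summand of \<open>b\<close> takes care of \<open>t \<le> l\<close>, where that
    estimate of \<open>q\<close> may fail.\<close>
  define H where "H = max 1 (3 * m / l)"
  define b where "b = \<bar>a\<bar> + \<bar>(f (2 * l) - f l) / l\<bar>"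
  have H1: "H \<ge> 1" by (simp add: H_def)
  have "slope_ratio_bound f k (H * k) b" if k: "k > 0" for k
    unfolding slope_ratio_bound_def
  proof (intro allI impI)
    fix p :: nat assume p: "p > 0"
    define t where "t = k * real p"
    have t: "t \<ge> k" "t > 0" using k p by (simp_all add: t_def)
    have Ht: "H * t > 0" using H1 t by simp
    have "(f t - f (t - k)) / k \<le> b + f (H * t) / (H * t)"
    proof (cases "t \<le> l")
      case True
      \<comment> \<open>For small \<open>t\<close> the slope is bounded by the fixed slope over
        \<open>[l, 2 * l]\<close>, and the ratio on the right is nonnegative.\<close>
      have "(f t - f (t - k)) / (t - (t - k)) \<le> (f (2 * l) - f l) / (2 * l - l)"
        using k l t True by (intro convex_on_slope_mono[OF conv]) auto
      then have "(f t - f (t - k)) / k \<le> (f (2 * l) - f l) / l" by simp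
      moreover have "0 \<le> f (H * t) / (H * t)" using nonneg Ht by simp
      ultimately show ?thesis unfolding b_def by linarith
    next
      case False
      \<comment> \<open>The extra \<open>1\<close> places the whole interval
        \<open>[l * q - l, l * q]\<close> to the right of \<open>t\<close>; rounding up alone would
        give a left end that may lie before \<open>t - k\<close> when \<open>k < l\<close>.\<close>
      define q where "q = nat \<lceil>t / l\<rceil> + 1"
      have q: "real q \<ge> t / l + 1" "real q \<le> t / l + 2" "q > 0"
        using t l unfolding q_def by (simp_all add: of_nat_nat) linarith+
      have "l * (t / l + 1) \<le> l * real q" using q l by (intro mult_left_mono) auto
      then have lq: "t + l \<le> l * real q" using l by (simp add: distrib_left)
      have "real q \<le> 3 * (t / l)" using q False l by (simp add: field_simps)
      then have "m * real q \<le> m * (3 * (t / l))" using m by (intro mult_left_mono) auto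
      also have "\<dots> = (3 * m / l) * t" by simp
      also have "\<dots> \<le> H * t" using t by (intro mult_right_mono) (auto simp: H_def)
      finally have mq: "m * real q \<le> H * t" .
      have "(f t - f (t - k)) / (t - (t - k))
          \<le> (f (l * real q) - f (l * real q - l)) / (l * real q - (l * real q - l))"
        using k l t lq q(3) by (intro convex_on_slope_mono[OF conv]) auto
      also have "\<dots> \<le> a + f (m * real q) / (m * real q)"
        using bound q unfolding slope_ratio_bound_def by simp
      also have "\<dots> \<le> a + f (H * t) / (H * t)"
        using m q mq by (intro add_left_mono convex_ratio_mono[OF conv f0]) auto
      also have "\<dots> \<le> b + f (H * t) / (H * t)"
        using abs_ge_zero[of "(f (2 * l) - f l) / l"] abs_ge_self[of a] unfolding b_def by linarith
      finally show ?thesis by simp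
    qed
    then show "(f (k * real p) - f (k * real p - k)) / k
        \<le> b + f (H * k * real p) / (H * k * real p)"
      by (simp add: t_def mult.assoc)
  qed
  then show ?thesis using H1 by (intro exI[of _ H] conjI exI[of _ b]) (auto simp: b_def)
qed

section \<open>The conjugate of a weight\<close>

lemma weights0_bdd_above_conjugate:
  assumes "\<omega> \<in> weights0"
  shows "bdd_above ((\<lambda>y. x * y - \<omega> (exp y)) ` {0..})"
proof -
  have nonneg: "\<And>t. t \<ge> 0 \<Longrightarrow> \<omega> t \<ge> 0" and ln_small: "ln \<in> o[at_top](\<omega>)"
    using assms by (auto simp: weights0_def)
  \<comment> \<open>The factor is chosen so that
    \<open>(\<bar>x\<bar> + 1) * y \<le> \<omega> (exp y)\<close> as soon as
    \<open>exp y \<ge> T\<close>; the remaining \<open>y\<close> form a bounded set.\<close>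
  have "eventually (\<lambda>t. norm (ln t) \<le> (1 / (\<bar>x\<bar> + 1)) * norm (\<omega> t)) at_top"
    by (rule landau_o.smallD[OF ln_small]) simp
  then obtain T where T: "\<And>t. t \<ge> T \<Longrightarrow> \<bar>ln t\<bar> \<le> (1 / (\<bar>x\<bar> + 1)) * \<bar>\<omega> t\<bar>"
    by (auto simp: eventually_at_top_linorder)
  show ?thesis
  proof (rule bdd_aboveI2)
    fix y :: real assume "y \<in> {0..}"
    then have y: "y \<ge> 0" by simp
    show "x * y - \<omega> (exp y) \<le> \<bar>x\<bar> * \<bar>T\<bar>"
    proof (cases "exp y \<ge> T")
      case True
      have "y \<le> (1 / (\<bar>x\<bar> + 1)) * \<omega> (exp y)" using T[OF True] y nonneg[of "exp y"] by simp
      then have "(\<bar>x\<bar> + 1) * y \<le> \<omega> (exp y)" by (simp add: field_simps)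
      moreover have "x * y \<le> (\<bar>x\<bar> + 1) * y" using y by (intro mult_right_mono) auto
      moreover have "0 \<le> \<bar>x\<bar> * \<bar>T\<bar>" by simp
      ultimately show ?thesis by linarith
    next
      case False
      then have "y \<le> \<bar>T\<bar>" using exp_ge_add_one_self[of y] by linarith
      then have "\<bar>x\<bar> * y \<le> \<bar>x\<bar> * \<bar>T\<bar>" by (intro mult_left_mono) auto
      moreover have "x * y \<le> \<bar>x\<bar> * y" using y by (intro mult_right_mono) auto
      ultimately show ?thesis using nonneg[of "exp y"] by simp
    qed
  qed
qed

lemma phi_star_upper:
  assumes "\<omega> \<in> weights0" "y \<ge> 0"
  shows "x * y - \<omega> (exp y) \<le> phi_star \<omega> x"
  unfolding phi_star_def
  using weights0_bdd_above_conjugate[OF assms(1)] assms(2) by (intro cSUP_upper) auto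

lemma phi_star_nonneg:
  assumes "\<omega> \<in> weights0"
  shows "phi_star \<omega> x \<ge> 0"
  using phi_star_upper[OF assms, of 0 x] assms by (simp add: weights0_def)

lemma phi_star_0:
  assumes "\<omega> \<in> weights0"
  shows "phi_star \<omega> 0 = 0"
proof (rule antisym)
  show "phi_star \<omega> 0 \<le> 0"
    unfolding phi_star_def using assms by (intro cSUP_least) (auto simp: weights0_def)
qed (rule phi_star_nonneg[OF assms])

text \<open>A supremum of affine functions of \<open>x\<close>, finite for every real
  \<open>x\<close>.\<close>

lemma convex_on_phi_star:
  assumes "\<omega> \<in> weights0"
  shows "convex_on UNIV (phi_star \<omega>)"
proof -
  have "convex_on UNIV (\<lambda>x. SUP y\<in>{0..}. x * y - \<omega> (exp y))"
    using convex_on_affine_real weights0_bdd_above_conjugate[OF assms]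
    by (intro convex_on_cSUP) (auto simp: mult.commute[of _ "_::real"])
  then show ?thesis by (simp add: phi_star_def[abs_def])
qed

section \<open>The weight associated with a sequence, in particular with
  \<open>weight_matrix \<omega> 1\<close>\<close>

lemma assoc_weight_in_weights0:
  assumes M0: "M 0 = 1" and M: "\<And>p. M p \<ge> 1"
    and bdd: "\<And>t. t > 0 \<Longrightarrow> bdd_above (range (\<lambda>p. ln (t ^ p / M p)))"
  shows "assoc_weight M \<in> weights0"
proof -
  let ?w = "assoc_weight M"
  have Mpos: "M p > 0" for p using M[of p] by linarith
  have term_eq: "ln (t ^ p / M p) = real p * ln t - ln (M p)" if "t > 0" for t p
    using that Mpos[of p] by (simp add: ln_div ln_realpow)
  have lower: "real p * ln t - ln (M p) \<le> ?w t" if "t > 0" for t p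
    using cSUP_upper[OF UNIV_I bdd[OF that], of p] that by (simp add: assoc_weight_def term_eq)
  \<comment> \<open>The index \<open>p = 0\<close> contributes the value \<open>0\<close> to the
    supremum.\<close>
  have nonneg: "?w t \<ge> 0" for t
    using lower[of t 0] M0 by (cases "t > 0") (auto simp: assoc_weight_def)
  have zero: "?w t = 0" if "t \<in> {0..1}" for t
  proof (rule antisym)
    show "?w t \<le> 0"
    proof (cases "t > 0")
      case True
      have "ln (t ^ p / M p) \<le> 0" for p
      proof -
        have "real p * ln t \<le> 0" using that True by (intro mult_nonneg_nonpos) auto
        then show ?thesis using True ln_ge_zero[OF M[of p]] by (simp add: term_eq)
      qed
      then show ?thesis using True by (auto simp: assoc_weight_def intro!: cSUP_least)
    qed (simp add: assoc_weight_def)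
  qed (rule nonneg)
  have mono: "?w s \<le> ?w t" if "0 \<le> s" "s \<le> t" for s t
  proof (cases "s > 0")
    case True
    then have t: "t > 0" using that by simp
    have "ln (s ^ p / M p) \<le> ?w t" for p
    proof -
      have "real p * ln s \<le> real p * ln t" using True that by (intro mult_left_mono) auto
      then show ?thesis using lower[OF t, of p] True by (simp add: term_eq)
    qed
    then show ?thesis using True by (subst assoc_weight_def) (auto intro!: cSUP_least)
  next
    case False
    then show ?thesis using nonneg[of t] by (simp add: assoc_weight_def)
  qed
  \<comment> \<open>In the variable \<open>y = ln t\<close> the weight is a supremum of affine
    functions with integer slopes.\<close>
  have exp_eq: "(\<lambda>y. ?w (exp y)) = (\<lambda>y. SUP p. real p * y - ln (M p))"
    by (rule ext) (simp add: assoc_weight_def term_eq)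
  have conv: "convex_on UNIV (\<lambda>y. ?w (exp y))"
    unfolding exp_eq
  proof (rule convex_on_cSUP)
    show "bdd_above (range (\<lambda>p. real p * y - ln (M p)))" for y
      using bdd[of "exp y"] by (simp add: term_eq)
  qed (auto intro: convex_on_affine_real)
  \<comment> \<open>A finite convex function on the line is continuous; composing with
    \<open>ln\<close> settles \<open>t \<ge> 1\<close>, and the zero function on
    \<open>[0, 1]\<close> is glued on at \<open>1\<close>.\<close>
  have cont: "continuous_on {0..} ?w"
  proof -
    have "continuous_on UNIV (\<lambda>y. ?w (exp y))" using conv by (intro convex_on_continuous) auto
    then have "continuous_on {1..} (\<lambda>t. ?w (exp (ln t)))"
      by (rule continuous_on_compose2) (auto intro!: continuous_intros)
    then have "continuous_on {1..} ?w" by (rule continuous_on_eq) auto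
    moreover have "continuous_on {0..1} ?w"
      by (rule continuous_on_eq[OF continuous_on_const[of _ 0]]) (use zero in auto)
    ultimately have "continuous_on ({0..1} \<union> {1..}) ?w"
      by (intro continuous_on_closed_Un) auto
    moreover have "{0..1} \<union> {1..} = {0::real..}" by auto
    ultimately show ?thesis by simp
  qed
  have lim: "filterlim ?w at_top at_top"
  proof (rule filterlim_at_top_mono)
    show "filterlim (\<lambda>t. - ln (M 1) + ln t) at_top at_top"
      by (intro filterlim_tendsto_add_at_top[OF tendsto_const] ln_at_top)
    show "eventually (\<lambda>t. - ln (M 1) + ln t \<le> ?w t) at_top"
      using eventually_gt_at_top[of 0] by eventually_elim (use lower[of _ 1] in auto)
  qed
  have small: "ln \<in> o[at_top](?w)"
  proof (rule landau_o.smallI)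
    fix c :: real assume c: "c > 0"
    \<comment> \<open>For large \<open>t\<close>, half of \<open>p * ln t\<close> absorbs
      \<open>ln (M p)\<close>; by the choice of \<open>p\<close> the other half still exceeds
      \<open>ln t / c\<close>.\<close>
    obtain p :: nat where p: "real p > 2 / c" using reals_Archimedean2 by blast
    have pos: "real p > 0" using p c by (smt (verit) divide_pos_pos)
    have "eventually (\<lambda>t. ln t \<ge> 2 * ln (M p) / real p) at_top"
      using ln_at_top by (simp add: filterlim_at_top)
    then show "eventually (\<lambda>t. norm (ln t) \<le> c * norm (?w t)) at_top"
      using eventually_ge_at_top[of 1]
    proof eventually_elim
      case (elim t)
      have "2 * ln (M p) \<le> real p * ln t" using elim pos by (simp add: field_simps)
      then have "real p * ln t \<le> 2 * ?w t" using lower[of t p] elim by simp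
      moreover have "(2 / c) * ln t \<le> real p * ln t" using p elim by (intro mult_right_mono) auto
      ultimately have "(2 / c) * ln t \<le> 2 * ?w t" by linarith
      then have "ln t \<le> c * ?w t" using c by (simp add: field_simps)
      then show ?case using elim nonneg[of t] by simp
    qed
  qed
  show ?thesis
    unfolding weights0_def using nonneg zero cont lim small conv
    by (auto intro!: mono_onI mono)
qed

text \<open>The conjugate involves only \<open>y \<ge> 0\<close>, that is \<open>t \<ge> 1\<close>,
  hence the \<open>max\<close>: for \<open>t < 1\<close> the term is nonpositive and
  \<open>\<omega> 1 = 0\<close>. As the bound does not depend on \<open>p\<close>, it gives
  finiteness of the associated weight and its comparison with \<open>\<omega>\<close>.\<close>

lemma weight_matrix_1_term_le:
  assumes "\<omega> \<in> weights0" "t > 0"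
  shows "ln (t ^ p / weight_matrix \<omega> 1 p) \<le> \<omega> (max 1 t)"
proof -
  have *: "ln (t ^ p / weight_matrix \<omega> 1 p) = real p * ln t - phi_star \<omega> (real p)"
    using assms(2) by (simp add: ln_div ln_realpow weight_matrix_def)
  show ?thesis
  proof (cases "t \<ge> 1")
    case True
    then show ?thesis using phi_star_upper[OF assms(1), of "ln t" "real p"] * by simp
  next
    case False
    then have "real p * ln t \<le> 0" using assms(2) by (simp add: mult_nonneg_nonpos)
    then show ?thesis
      using * False phi_star_nonneg[OF assms(1), of "real p"] assms(1)
      by (simp add: weights0_def)
  qed
qed

lemma bdd_above_weight_matrix_1:
  assumes "\<omega> \<in> weights0" "t > 0"
  shows "bdd_above (range (\<lambda>p. ln (t ^ p / weight_matrix \<omega> 1 p)))"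
  using weight_matrix_1_term_le[OF assms] by (intro bdd_aboveI2) auto

lemma assoc_weight_matrix_1_in_weights0:
  assumes "\<omega> \<in> weights0"
  shows "assoc_weight (weight_matrix \<omega> 1) \<in> weights0"
  using assms bdd_above_weight_matrix_1[OF assms] phi_star_nonneg[OF assms] phi_star_0[OF assms]
  by (intro assoc_weight_in_weights0) (auto simp: weight_matrix_def)

text \<open>In the variable \<open>y\<close>, the associated weight is the supremum of the lines
  \<open>q * y - phi_star \<omega> q\<close> with integer \<open>q\<close>. It lies below
  \<open>\<omega>\<close> for \<open>y \<ge> 0\<close> and above each of these lines, so conjugation
  returns the same values at the integers.\<close>

lemma weight_matrix_1_assoc_weight:
  assumes \<omega>: "\<omega> \<in> weights0"
  shows "weight_matrix (assoc_weight (weight_matrix \<omega> 1)) 1 = weight_matrix \<omega> 1"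
proof
  fix q
  let ?w = "assoc_weight (weight_matrix \<omega> 1)"
  have w: "?w \<in> weights0" by (rule assoc_weight_matrix_1_in_weights0[OF \<omega>])
  have "phi_star ?w (real q) = phi_star \<omega> (real q)"
  proof (rule antisym)
    show "phi_star ?w (real q) \<le> phi_star \<omega> (real q)"
      unfolding phi_star_def[of ?w]
    proof (rule cSUP_least)
      fix y :: real
      have "ln (exp y ^ q / weight_matrix \<omega> 1 q) \<le> ?w (exp y)"
        using cSUP_upper[OF UNIV_I bdd_above_weight_matrix_1[OF \<omega>, of "exp y"], of q]
        by (simp add: assoc_weight_def)
      then show "real q * y - ?w (exp y) \<le> phi_star \<omega> (real q)"
        by (simp add: ln_div ln_realpow weight_matrix_def)
    qed auto
    show "phi_star \<omega> (real q) \<le> phi_star ?w (real q)"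
      unfolding phi_star_def[of \<omega>]
    proof (rule cSUP_least)
      fix y :: real assume "y \<in> {0..}"
      then have y: "y \<ge> 0" by simp
      \<comment> \<open>Conjugation reverses this inequality.\<close>
      have "?w (exp y) \<le> \<omega> (exp y)"
        using weight_matrix_1_term_le[OF \<omega>, of "exp y"] y
        by (auto simp: assoc_weight_def max_def intro!: cSUP_least)
      then show "real q * y - \<omega> (exp y) \<le> phi_star ?w (real q)"
        using phi_star_upper[OF w y, of "real q"] by linarith
    qed auto
  qed
  then show "weight_matrix ?w 1 q = weight_matrix \<omega> 1 q" by (simp add: weight_matrix_def)
qed

section \<open>Quotients and roots in logarithmic form\<close>

lemma quotient_root_iff_slope_ratio_bound:
  assumes "l > 0" "A > 0"
  shows "(\<forall>p>0. quotient_seq (weight_matrix \<omega> l) p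
            \<le> A * weight_matrix \<omega> m p powr (1 / real p))
    \<longleftrightarrow> slope_ratio_bound (phi_star \<omega>) l m (ln A)"
proof -
  let ?f = "phi_star \<omega>"
  have "quotient_seq (weight_matrix \<omega> l) p \<le> A * weight_matrix \<omega> m p powr (1 / real p)
    \<longleftrightarrow> (?f (l * real p) - ?f (l * real p - l)) / l \<le> ln A + ?f (m * real p) / (m * real p)"
    if p: "p > 0" for p
  proof -
    \<comment> \<open>For \<open>p > 0\<close> the argument for the index \<open>p - 1\<close> is
      \<open>l * p - l\<close>, and the prefactor \<open>1 / l\<close> turns the difference into a
      slope.\<close>
    have "quotient_seq (weight_matrix \<omega> l) p = exp ((?f (l * real p) - ?f (l * real p - l)) / l)"
      using p by (simp add: quotient_seq_def weight_matrix_def exp_diff [symmetric]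
          diff_divide_distrib of_nat_diff right_diff_distrib)
    moreover have "A * weight_matrix \<omega> m p powr (1 / real p)
        = exp (ln A + ?f (m * real p) / (m * real p))"
      using p assms(2) by (simp add: weight_matrix_def powr_def exp_add mult.commute)
    ultimately show ?thesis by simp
  qed
  then show ?thesis unfolding slope_ratio_bound_def by blast
qed

text \<open>The root depends only on the product of parameter and index, so dilating the index by
  \<open>d\<close> in the sequence for \<open>1\<close> amounts to passing to the parameter
  \<open>d\<close>.\<close>

lemma weight_matrix_1_root:
  assumes "d > 0"
  shows "weight_matrix \<omega> 1 (d * p) powr (1 / real (d * p))
    = weight_matrix \<omega> (real d) p powr (1 / real p)"
  using assms by (simp add: weight_matrix_def powr_def)

text \<open>The weakest form of the comparison, for a single pair of parameters; it is the common
  middle term of all the equivalences.\<close>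

definition comparable_pair :: "(real \<Rightarrow> real) \<Rightarrow> bool" where
  "comparable_pair \<omega> \<longleftrightarrow> (\<exists>l>0. \<exists>m>0. \<exists>a. slope_ratio_bound (phi_star \<omega>) l m a)"

lemma comparable_pairI:
  assumes "l > 0" "m > 0" "A \<ge> 1"
    "\<forall>p>0. quotient_seq (weight_matrix \<omega> l) p \<le> A * weight_matrix \<omega> m p powr (1 / real p)"
  shows "comparable_pair \<omega>"
proof -
  have "A > 0" using assms(3) by simp
  with assms have "slope_ratio_bound (phi_star \<omega>) l m (ln A)"
    using quotient_root_iff_slope_ratio_bound[of l A \<omega> m] by simp
  with assms(1,2) show ?thesis unfolding comparable_pair_def by blast
qed

text \<open>The strongest form: \<open>A\<close> and \<open>H\<close> are common to all parameters.
  Allowing every \<open>m \<ge> H * k\<close> leaves room for rounding \<open>H\<close> to an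
  integer later.\<close>

lemma comparable_pair_uniform:
  assumes \<omega>: "\<omega> \<in> weights0" and "comparable_pair \<omega>"
  obtains A H where "A \<ge> 1" "H \<ge> 1"
    "\<And>k m p. k > 0 \<Longrightarrow> m \<ge> H * k \<Longrightarrow> p > 0 \<Longrightarrow>
      quotient_seq (weight_matrix \<omega> k) p \<le> A * weight_matrix \<omega> m p powr (1 / real p)"
proof -
  have conv: "convex_on {0..} (phi_star \<omega>)"
    using convex_on_phi_star[OF \<omega>] by (rule convex_on_subset) auto
  obtain H b where H: "H \<ge> 1" "b \<ge> 0"
    and all: "\<And>k. k > 0 \<Longrightarrow> slope_ratio_bound (phi_star \<omega>) k (H * k) b"
    using assms(2) slope_ratio_bound_uniform[OF conv phi_star_0[OF \<omega>] phi_star_nonneg[OF \<omega>]]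
    unfolding comparable_pair_def by metis
  have bound: "slope_ratio_bound (phi_star \<omega>) k m (ln (exp b))" if "k > 0" "m \<ge> H * k" for k m
    using slope_ratio_bound_mono[OF conv phi_star_0[OF \<omega>] _ that(2) all[OF that(1)]] H that
    by simp
  have le: "quotient_seq (weight_matrix \<omega> k) p \<le> exp b * weight_matrix \<omega> m p powr (1 / real p)"
    if "k > 0" "m \<ge> H * k" "p > 0" for k m p
    by (rule quotient_root_iff_slope_ratio_bound[OF that(1) exp_gt_zero, THEN iffD2,
          OF bound[OF that(1,2)], rule_format, OF that(3)])
  show ?thesis
  proof (rule that)
    show "exp b \<ge> 1" "H \<ge> 1" using H by simp_all
  qed (rule le)
qed

section \<open>Each condition is equivalent to \<open>comparable_pair\<close>\<close>

context
  fixes \<omega> :: "real \<Rightarrow> real"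
  assumes \<omega>: "\<omega> \<in> weights0"
begin

lemma quotient_root_Roumieu_iff:
  "quotient_root_Roumieu (weight_matrix \<omega>) \<longleftrightarrow> comparable_pair \<omega>"
proof
  assume "quotient_root_Roumieu (weight_matrix \<omega>)"
  then obtain y A where "y > 0" "A \<ge> 1"
    "\<forall>p>0. quotient_seq (weight_matrix \<omega> 1) p \<le> A * weight_matrix \<omega> y p powr (1 / real p)"
    unfolding quotient_root_Roumieu_def using zero_less_one by blast
  then show "comparable_pair \<omega>" by (intro comparable_pairI[of 1 y A]) auto
next
  assume "comparable_pair \<omega>"
  then obtain A H where AH: "A \<ge> 1" "H \<ge> 1" "\<And>k m p. k > 0 \<Longrightarrow> m \<ge> H * k \<Longrightarrow> p > 0 \<Longrightarrow>
      quotient_seq (weight_matrix \<omega> k) p \<le> A * weight_matrix \<omega> m p powr (1 / real p)"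
    by (rule comparable_pair_uniform[OF \<omega>]) blast
  show "quotient_root_Roumieu (weight_matrix \<omega>)"
    unfolding quotient_root_Roumieu_def
  proof (intro allI impI)
    fix x :: real assume x: "x > 0"
    then have y: "H * x > 0" using AH(2) by simp
    from x have "\<forall>p>0. quotient_seq (weight_matrix \<omega> x) p
        \<le> A * weight_matrix \<omega> (H * x) p powr (1 / real p)"
      by (intro allI impI AH(3) order.refl)
    with y AH(1) show "\<exists>y>0. \<exists>A\<ge>1. \<forall>p>0. quotient_seq (weight_matrix \<omega> x) p
        \<le> A * weight_matrix \<omega> y p powr (1 / real p)"
      by blast
  qed
qed

lemma quotient_root_Beurling_iff:
  "quotient_root_Beurling (weight_matrix \<omega>) \<longleftrightarrow> comparable_pair \<omega>"
proof
  assume "quotient_root_Beurling (weight_matrix \<omega>)"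
  then obtain y A where "y > 0" "A \<ge> 1"
    "\<forall>p>0. quotient_seq (weight_matrix \<omega> y) p \<le> A * weight_matrix \<omega> 1 p powr (1 / real p)"
    unfolding quotient_root_Beurling_def using zero_less_one by blast
  then show "comparable_pair \<omega>" by (intro comparable_pairI[of y 1 A]) auto
next
  assume "comparable_pair \<omega>"
  then obtain A H where AH: "A \<ge> 1" "H \<ge> 1" "\<And>k m p. k > 0 \<Longrightarrow> m \<ge> H * k \<Longrightarrow> p > 0 \<Longrightarrow>
      quotient_seq (weight_matrix \<omega> k) p \<le> A * weight_matrix \<omega> m p powr (1 / real p)"
    by (rule comparable_pair_uniform[OF \<omega>]) blast
  show "quotient_root_Beurling (weight_matrix \<omega>)"
    unfolding quotient_root_Beurling_def
  proof (intro allI impI)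
    fix x :: real assume "x > 0"
    \<comment> \<open>In the Beurling case the given parameter is the larger one, so the dilation by
      \<open>H\<close> is undone.\<close>
    then have y: "x / H > 0" "x \<ge> H * (x / H)" using AH(2) by simp_all
    from y have "\<forall>p>0. quotient_seq (weight_matrix \<omega> (x / H)) p
        \<le> A * weight_matrix \<omega> x p powr (1 / real p)"
      by (intro allI impI AH(3))
    with y(1) AH(1) show "\<exists>y>0. \<exists>A\<ge>1. \<forall>p>0. quotient_seq (weight_matrix \<omega> y) p
        \<le> A * weight_matrix \<omega> x p powr (1 / real p)"
      by blast
  qed
qed

lemma uniform_comparison_iff:
  "(\<exists>A\<ge>1::real. \<exists>c\<ge>1::real. \<forall>x>0::nat. \<forall>p>0::nat.
      quotient_seq (weight_matrix \<omega> (real x)) p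
        \<le> A * weight_matrix \<omega> (c * real x) p powr (1 / real p)) \<longleftrightarrow> comparable_pair \<omega>"
  (is "?L \<longleftrightarrow> _")
proof
  assume ?L
  then obtain A c where Ac: "A \<ge> 1" "c \<ge> 1" "\<And>x p::nat. x > 0 \<Longrightarrow> p > 0 \<Longrightarrow>
      quotient_seq (weight_matrix \<omega> (real x)) p
        \<le> A * weight_matrix \<omega> (c * real x) p powr (1 / real p)"
    by blast
  then show "comparable_pair \<omega>"
    using Ac(3)[of 1] by (intro comparable_pairI[of 1 c A]) auto
next
  assume "comparable_pair \<omega>"
  then obtain A H where AH: "A \<ge> 1" "H \<ge> 1" "\<And>k m p. k > 0 \<Longrightarrow> m \<ge> H * k \<Longrightarrow> p > 0 \<Longrightarrow>
      quotient_seq (weight_matrix \<omega> k) p \<le> A * weight_matrix \<omega> m p powr (1 / real p)"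
    by (rule comparable_pair_uniform[OF \<omega>]) blast
  have "\<forall>x>0::nat. \<forall>p>0::nat. quotient_seq (weight_matrix \<omega> (real x)) p
      \<le> A * weight_matrix \<omega> (H * real x) p powr (1 / real p)"
    by (intro allI impI AH(3)) simp_all
  with AH(1,2) show ?L by blast
qed

lemma reciprocal_comparison_iff:
  "(\<exists>c\<ge>1::real. \<forall>x>0::nat. \<exists>A\<ge>1::real. \<forall>p>0::nat.
      quotient_seq (weight_matrix \<omega> (1 / (c * real x))) p
        \<le> A * weight_matrix \<omega> (1 / real x) p powr (1 / real p)) \<longleftrightarrow> comparable_pair \<omega>"
  (is "?L \<longleftrightarrow> _")
proof
  assume ?L
  then obtain c where c: "c \<ge> 1" "\<And>x::nat. x > 0 \<Longrightarrow> \<exists>A\<ge>1::real. \<forall>p>0::nat.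
      quotient_seq (weight_matrix \<omega> (1 / (c * real x))) p
        \<le> A * weight_matrix \<omega> (1 / real x) p powr (1 / real p)"
    by blast
  then obtain A where "A \<ge> 1" "\<forall>p>0. quotient_seq (weight_matrix \<omega> (1 / c)) p
        \<le> A * weight_matrix \<omega> 1 p powr (1 / real p)"
    using c(2)[of 1] by auto
  then show "comparable_pair \<omega>"
    using c(1) by (intro comparable_pairI[of "1 / c" 1 A]) auto
next
  assume "comparable_pair \<omega>"
  then obtain A H where AH: "A \<ge> 1" "H \<ge> 1" "\<And>k m p. k > 0 \<Longrightarrow> m \<ge> H * k \<Longrightarrow> p > 0 \<Longrightarrow>
      quotient_seq (weight_matrix \<omega> k) p \<le> A * weight_matrix \<omega> m p powr (1 / real p)"
    by (rule comparable_pair_uniform[OF \<omega>]) blast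
  have "H > 0" using AH(2) by simp
  \<comment> \<open>Dilating \<open>1 / (H * x)\<close> by \<open>H\<close> gives exactly
    \<open>1 / x\<close>, so \<open>c = H\<close> works.\<close>
  then have "\<forall>x>0::nat. \<forall>p>0::nat. quotient_seq (weight_matrix \<omega> (1 / (H * real x))) p
      \<le> A * weight_matrix \<omega> (1 / real x) p powr (1 / real p)"
    by (intro allI impI AH(3)) simp_all
  with AH(1,2) show ?L by blast
qed

lemma single_sequence_comparison_iff:
  "(\<exists>d>0::nat. \<exists>A\<ge>1::real. \<forall>p>0::nat.
      quotient_seq (weight_matrix \<omega> 1) p
        \<le> A * weight_matrix \<omega> 1 (d * p) powr (1 / real (d * p))) \<longleftrightarrow> comparable_pair \<omega>"
  (is "?L \<longleftrightarrow> _")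
proof
  assume ?L
  then obtain d :: nat and A where d: "d > 0" and A: "A \<ge> 1" and le: "\<And>p. p > 0 \<Longrightarrow>
      quotient_seq (weight_matrix \<omega> 1) p
        \<le> A * weight_matrix \<omega> 1 (d * p) powr (1 / real (d * p))"
    by blast
  from le have "\<forall>p>0. quotient_seq (weight_matrix \<omega> 1) p
      \<le> A * weight_matrix \<omega> (real d) p powr (1 / real p)"
    unfolding weight_matrix_1_root[OF d] by blast
  with d A show "comparable_pair \<omega>" by (intro comparable_pairI[of 1 "real d" A]) auto
next
  assume "comparable_pair \<omega>"
  then obtain A H where AH: "A \<ge> 1" "H \<ge> 1" "\<And>k m p. k > 0 \<Longrightarrow> m \<ge> H * k \<Longrightarrow> p > 0 \<Longrightarrow>
      quotient_seq (weight_matrix \<omega> k) p \<le> A * weight_matrix \<omega> m p powr (1 / real p)"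
    by (rule comparable_pair_uniform[OF \<omega>]) blast
  \<comment> \<open>An integer above \<open>H\<close> is admissible because the uniform comparison
    holds for all \<open>m \<ge> H * k\<close>.\<close>
  obtain d :: nat where d: "real d > H" using reals_Archimedean2 by blast
  then have d0: "d > 0" using AH(2) by (cases d) auto
  have "\<forall>p>0. quotient_seq (weight_matrix \<omega> 1) p
      \<le> A * weight_matrix \<omega> 1 (d * p) powr (1 / real (d * p))"
    unfolding weight_matrix_1_root[OF d0] using d by (intro allI impI AH(3)) simp_all
  with d0 AH(1) show ?L by blast
qed

end

text \<open>The single-sequence criterion mentions only the sequence with parameter
  \<open>1\<close>, which both weights share.\<close>

lemma comparable_pair_assoc_weight:
  assumes "\<omega> \<in> weights0"
  shows "comparable_pair (assoc_weight (weight_matrix \<omega> 1)) \<longleftrightarrow> comparable_pair \<omega>"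
  by (rule trans[OF sym[OF single_sequence_comparison_iff[OF
          assoc_weight_matrix_1_in_weights0[OF assms], unfolded weight_matrix_1_assoc_weight[OF assms]]]
        single_sequence_comparison_iff[OF assms]])

theorem proposition4p7:
  fixes \<omega> :: "real \<Rightarrow> real"
  assumes "\<omega> \<in> weights0"
  shows "assoc_weight (weight_matrix \<omega> 1) \<in> weights0 \<and>
    (\<forall>P \<in> {quotient_root_Roumieu, quotient_root_Beurling,
            \<lambda>M. quotient_root_Roumieu M \<and> quotient_root_Beurling M}.
      (P (weight_matrix \<omega>) \<longleftrightarrow>
        (\<exists>A\<ge>1::real. \<exists>c\<ge>1::real. \<forall>x>0::nat. \<forall>p>0::nat.
          quotient_seq (weight_matrix \<omega> (real x)) p
            \<le> A * weight_matrix \<omega> (c * real x) p powr (1 / real p))) \<and>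
      (P (weight_matrix \<omega>) \<longleftrightarrow>
        (\<exists>c\<ge>1::real. \<forall>x>0::nat. \<exists>A\<ge>1::real. \<forall>p>0::nat.
          quotient_seq (weight_matrix \<omega> (1 / (c * real x))) p
            \<le> A * weight_matrix \<omega> (1 / real x) p powr (1 / real p))) \<and>
      (P (weight_matrix \<omega>) \<longleftrightarrow>
        (\<exists>d>0::nat. \<exists>A\<ge>1::real. \<forall>p>0::nat.
          quotient_seq (weight_matrix \<omega> 1) p
            \<le> A * weight_matrix \<omega> 1 (d * p) powr (1 / real (d * p)))) \<and>
      (P (weight_matrix \<omega>) \<longleftrightarrow>
        P (weight_matrix (assoc_weight (weight_matrix \<omega> 1)))))"
proof -
  let ?w = "assoc_weight (weight_matrix \<omega> 1)"
  have w: "?w \<in> weights0" by (rule assoc_weight_matrix_1_in_weights0[OF assms])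
  \<comment> \<open>The Roumieu and Beurling types reduce to the same condition, hence so does their
    conjunction.\<close>
  have "(P (weight_matrix \<omega>) \<longleftrightarrow> comparable_pair \<omega>) \<and> (P (weight_matrix ?w) \<longleftrightarrow> comparable_pair \<omega>)"
    if "P \<in> {quotient_root_Roumieu, quotient_root_Beurling,
            \<lambda>M. quotient_root_Roumieu M \<and> quotient_root_Beurling M}" for P
    using that
    by (auto simp: quotient_root_Roumieu_iff[OF assms] quotient_root_Beurling_iff[OF assms]
        quotient_root_Roumieu_iff[OF w] quotient_root_Beurling_iff[OF w]
        comparable_pair_assoc_weight[OF assms])
  with w show ?thesis
    unfolding uniform_comparison_iff[OF assms] reciprocal_comparison_iff[OF assms]
      single_sequence_comparison_iff[OF assms]
    by blast
qed

end
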